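(* Let $f\in\mathbb{R}[\theta_1,\dots,\theta_d]$ be a complete hyperbolic polynomial with hyperbolicity cone $C\subset\mathbb{R}^d$, let $K=C^\vee$, and let $F=\nabla\log f=\frac{1}{f}\nabla f$ on $C$. Let $\mathcal{L}\subset\mathbb{R}^d$ be a linear subspace of dimension $c$ with $\mathcal{L}\cap C\neq\emptyset$, and let $L\in\mathbb{R}^{c\times d}$ be a matrix whose rows form a basis of $\mathcal{L}$. Let $C_{\mathcal{L}}=C\cap\mathcal{L}$, regarded as the subset $\{\tau\in\mathbb{R}^c : L^T\tau\in C\}$ of $\mathbb{R}^c$, let $K_{\mathcal{L}}=L(K)=(C_{\mathcal{L}})^\vee\subset\mathbb{R}^c$, and let $F_{\mathcal{L}}(\tau)=\nabla_\tau \log f(L^T\tau)$ for $\tau\in C_{\mathcal{L}}$. Then $F_{\mathcal{L}}$ can be written as the composition of the maps $$C_{\mathcal{L}}\;\subset\; C\;\overset{F}{\longrightarrow}\;K\;\overset{L}{\longrightarrow}\;K_{\mathcal{L}},$$ where the inclusion is $\tau\mapsto L^T\tau$. Moreover, $C_{\mathcal{L}}$ maps bijectively (under $\tau\mapsto F(L^T\tau)$) onto the positive exponential variety $\mathcal{L}^F_{\succ 0}=F(C\cap\mathcal{L})$, and $\mathcal{L}^F_{\succ 0}$ maps bijectively (under $L$) onto the interior of $K_{\mathcal{L}}$.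
   Context: A homogeneous polynomial $f$ of degree $p$ in $\theta=(\theta_1,\dots,\theta_d)$ is hyperbolic if there is $\tau_0\in\mathbb{R}^d$ with $f(\tau_0)\ne0$ such that every line through $\tau_0$ meets $\{f=0\}$ in $p$ real points counting multiplicities (equivalently, for every $\eta\in\mathbb{R}^d$ the polynomial $t\mapsto f(\eta+t\tau_0)$ has only real roots). Its hyperbolicity cone $C$ is the connected component of $\mathbb{R}^d\setminus\{f=0\}$ containing $\tau_0$; it is an open convex cone. $f$ is complete if $C$ is pointed, i.e. $\overline{C}\cap(-\overline{C})=\{0\}$. The closed dual cone is $C^\vee=\{\sigma\in\mathbb{R}^d:\langle\theta,\sigma\rangle\ge 0\ \forall\,\theta\in C\}$, with the standard inner product, and similarly in $\mathbb{R}^c$. The sign of $f$ is chosen so that $f>0$ on $C$. *)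

theory Defs
  imports "HOL-Analysis.Analysis" "HOL-Library.Poly_Mapping"
begin

text \<open>
  A real polynomial in variables indexed by a finite type is a finitely supported map from
  exponent vectors to coefficients.  Evaluation is polymorphic in the point so that the same
  polynomial can be evaluated at real and at complex points.
\<close>

type_synonym 'n real_mpoly = "('n \<Rightarrow>\<^sub>0 nat) \<Rightarrow>\<^sub>0 real"

definition mpoly_eval :: "'n::finite real_mpoly \<Rightarrow> 'a::{real_algebra_1,comm_ring_1} ^ 'n \<Rightarrow> 'a" where
  "mpoly_eval f x =
     (\<Sum>m\<in>Poly_Mapping.keys f.
        of_real (Poly_Mapping.lookup f m) * (\<Prod>i\<in>UNIV. (x $ i) ^ Poly_Mapping.lookup m i))"

definition homogeneous_mpoly :: "nat \<Rightarrow> 'n::finite real_mpoly \<Rightarrow> bool" where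
  "homogeneous_mpoly p f \<longleftrightarrow>
     (\<forall>m\<in>Poly_Mapping.keys f. (\<Sum>i\<in>UNIV. Poly_Mapping.lookup m i) = p)"

text \<open>
  Real-rootedness of \<open>t \<mapsto> f (\<eta> + t \<tau>\<^sub>0)\<close> is expressed through its complex zeros.  As
  \<open>f \<tau>\<^sub>0\<close> is the coefficient of \<open>t ^ p\<close>, this polynomial has degree exactly \<open>p\<close>, so it has
  \<open>p\<close> real zeros counted with multiplicity.
\<close>

definition hyperbolic_mpoly :: "nat \<Rightarrow> 'n::finite real_mpoly \<Rightarrow> real ^ 'n \<Rightarrow> bool" where
  "hyperbolic_mpoly p f \<tau>\<^sub>0 \<longleftrightarrow>
     homogeneous_mpoly p f \<and> mpoly_eval f \<tau>\<^sub>0 \<noteq> 0 \<and>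
     (\<forall>\<eta> :: real ^ 'n. \<forall>t :: complex.
        mpoly_eval f (\<chi> i. of_real (\<eta> $ i) + t * of_real (\<tau>\<^sub>0 $ i)) = 0 \<longrightarrow> t \<in> \<real>)"

definition hyperbolicity_cone :: "'n::finite real_mpoly \<Rightarrow> real ^ 'n \<Rightarrow> (real ^ 'n) set" where
  "hyperbolicity_cone f \<tau>\<^sub>0 = connected_component_set {\<theta>. mpoly_eval f \<theta> \<noteq> 0} \<tau>\<^sub>0"

definition pointed_cone :: "'a::real_normed_vector set \<Rightarrow> bool" where
  "pointed_cone C \<longleftrightarrow> closure C \<inter> uminus ` closure C = {0}"

definition complete_hyperbolic :: "nat \<Rightarrow> 'n::finite real_mpoly \<Rightarrow> real ^ 'n \<Rightarrow> bool" where
  "complete_hyperbolic p f \<tau>\<^sub>0 \<longleftrightarrow>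
     hyperbolic_mpoly p f \<tau>\<^sub>0 \<and> pointed_cone (hyperbolicity_cone f \<tau>\<^sub>0)"

definition dual_cone :: "'a::real_inner set \<Rightarrow> 'a set" where
  "dual_cone S = {\<sigma>. \<forall>\<theta>\<in>S. 0 \<le> \<theta> \<bullet> \<sigma>}"

definition gradient :: "('a::real_inner \<Rightarrow> real) \<Rightarrow> 'a \<Rightarrow> 'a" where
  "gradient g x = (THE D. GDERIV g x :> D)"

lemma gradient_eqI:
  assumes "GDERIV g x :> D"
  shows "gradient g x = D"
  unfolding gradient_def
proof (rule the_equality)
  show "GDERIV g x :> D" by fact
next
  fix E assume "GDERIV g x :> E"
  with assms have "(\<lambda>h. h \<bullet> E) = (\<lambda>h. h \<bullet> D)"
    unfolding gderiv_def by (rule has_derivative_unique[rotated])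
  then show "E = D"
    by (metis inner_commute vector_eq_ldot)
qed

end

theory Submission
  imports Defs "HOL-Computational_Algebra.Fundamental_Theorem_Algebra"
begin

text \<open>
  For \<open>b \<in> C\<close> and any direction \<open>v\<close>, hyperbolicity gives
  \<open>f (b + s v) = f b * (\<Prod>j<p. 1 + s * \<mu> j)\<close> with real \<open>\<mu> j\<close>: the cone consists of the points
  reachable from \<open>a\<close> by a segment avoiding the zeros of \<open>f\<close>, and by Garding's argument \<open>f\<close> is
  hyperbolic in every direction of its cone.  Hence \<open>v \<bullet> F b = \<Sum> \<mu> j\<close>, which yields the inclusion
  \<open>F ` C \<subseteq> K\<close> and, as the cone is pointed, the strict monotonicity of \<open>F\<close> and so injectivity of
  the composite gradient map on the section.  A point \<open>\<sigma>\<close> in the interior of the dual of the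
  section is attained at the maximizer of \<open>f\<close> on the compact slice \<open>\<tau> \<bullet> \<sigma> = p\<close>.  Consequently
  the interior of the dual of the section lies in \<open>L K\<close>, and since \<open>L K\<close> is closed the two
  cones coincide.
\<close>

subsection \<open>Polynomials on complex lines\<close>

definition complexify :: "real ^ 'n \<Rightarrow> complex ^ 'n" where
  "complexify x = (\<chi> i. of_real (x $ i))"

lemma complexify_add: "complexify (x + y) = complexify x + complexify y"
  by (simp add: complexify_def vec_eq_iff)

lemma complexify_scale: "complexify (c *s x) = of_real c *s complexify x"
  by (simp add: complexify_def vec_eq_iff)

lemma mpoly_eval_complexify: "mpoly_eval f (complexify x) = of_real (mpoly_eval f x)"
  by (simp add: mpoly_eval_def complexify_def)

lemma mpoly_eval_scale:
  assumes "homogeneous_mpoly p f"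
  shows "mpoly_eval f (c *s x) = c ^ p * mpoly_eval f x"
proof -
  have "(\<Prod>i\<in>UNIV. ((c *s x) $ i) ^ Poly_Mapping.lookup m i)
      = c ^ p * (\<Prod>i\<in>UNIV. (x $ i) ^ Poly_Mapping.lookup m i)" if "m \<in> Poly_Mapping.keys f" for m
    using assms that
    by (simp add: homogeneous_mpoly_def power_mult_distrib prod.distrib flip: power_sum)
  then show ?thesis
    by (simp add: mpoly_eval_def sum_distrib_left mult.left_commute cong: sum.cong)
qed

lemma continuous_on_mpoly_eval [continuous_intros]:
  fixes g :: "'b::topological_space \<Rightarrow> 'a::real_normed_field ^ 'n::finite"
  assumes "continuous_on S g"
  shows "continuous_on S (\<lambda>x. mpoly_eval f (g x))"
  unfolding mpoly_eval_def by (intro continuous_intros assms)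

lemma continuous_on_vector_scalar_mult [continuous_intros]:
  fixes g :: "'b::topological_space \<Rightarrow> 'a::real_normed_field ^ 'n::finite"
  assumes "continuous_on S c" "continuous_on S g"
  shows "continuous_on S (\<lambda>x. c x *s g x)"
  unfolding vector_scalar_mult_def by (intro continuous_intros assms)

lemma norm_vector_scalar_mult:
  "norm (c *s x) = norm c * norm x" for x :: "'a::real_normed_field ^ 'n::finite"
  by (simp add: norm_vec_def norm_mult L2_set_right_distrib)

text \<open>\<open>gradient\<close> is a definite description, so a derivative has to be shown to
  exist. Its representing vector is the adjoint of the derivative applied to 1.\<close>

lemma mpoly_eval_GDERIV:
  "\<exists>D. GDERIV (mpoly_eval f) x :> D" for x :: "real ^ 'n::finite"
proof -
  have "\<exists>f'. (mpoly_eval f has_derivative f') (at x)"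
    unfolding mpoly_eval_def[abs_def]
    by (rule exI) (auto intro!: derivative_eq_intros has_derivative_prod bounded_linear_imp_has_derivative)
  then obtain f' where f': "(mpoly_eval f has_derivative f') (at x)" ..
  then have "linear f'"
    by (rule has_derivative_linear)
  then have "f' = (\<lambda>h. h \<bullet> adjoint f' 1)"
    by (simp add: adjoint_works)
  with f' show ?thesis
    unfolding gderiv_def by metis
qed

text \<open>The bounds \<open>n i\<close> need not be attained: if one of them is strict, both sides
  of the coefficient formula are 0. This matters because leading coefficients \<open>b $ i\<close>
  of the linear factors below may vanish.\<close>

lemma coeff_prod_degree_bound:
  assumes "finite I" "\<And>i. i \<in> I \<Longrightarrow> degree (q i) \<le> n i"
  shows "degree (\<Prod>i\<in>I. q i) \<le> (\<Sum>i\<in>I. n i)"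
    and "coeff (\<Prod>i\<in>I. q i) (\<Sum>i\<in>I. n i) = (\<Prod>i\<in>I. coeff (q i) (n i))"
  using assms
proof (induction I rule: finite_induct)
  case (insert j I)
  { case 1
    then show ?case
      using insert by (auto intro!: degree_mult_le[THEN order_trans] add_mono) }
  { case 2
    have "coeff (q * r) (k + l) = coeff q k * coeff r l"
      if "degree q \<le> k" "degree r \<le> l" for q r :: "'b poly" and k l
    proof (cases "degree q = k \<and> degree r = l")
      case True
      then show ?thesis using coeff_mult_degree_sum by auto
    next
      case False
      with that have "degree (q * r) < k + l"
        using degree_mult_le[of q r] by linarith
      moreover have "coeff q k = 0 \<or> coeff r l = 0"
        using False that by (metis coeff_eq_0 order_le_imp_less_or_eq)
      ultimately show ?thesis by (auto simp: coeff_eq_0)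
    qed
    with 2 insert show ?case by simp }
qed auto

text \<open>
  The coefficient of \<open>s ^ p\<close> in \<open>f (x + s b)\<close> is \<open>f b\<close>.
\<close>

lemma mpoly_eval_line_factorization:
  fixes x b :: "complex ^ 'n::finite"
  assumes hom: "homogeneous_mpoly p f" and nz: "mpoly_eval f b \<noteq> 0"
  obtains R where "size R = p" "\<And>s. mpoly_eval f (x + s *s b) = mpoly_eval f b * (\<Prod>r\<in>#R. s - r)"
proof -
  define q where "q m = (\<Prod>i\<in>UNIV. [:x $ i, b $ i:] ^ Poly_Mapping.lookup m i)" for m
  define P where "P = (\<Sum>m\<in>Poly_Mapping.keys f. smult (of_real (Poly_Mapping.lookup f m)) (q m))"
  have lin: "degree ([:x $ i, b $ i:] ^ k) \<le> k" "coeff ([:x $ i, b $ i:] ^ k) k = (b $ i) ^ k" for i k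
  proof -
    show "degree ([:x $ i, b $ i:] ^ k) \<le> k"
      by (rule degree_power_le[THEN order_trans]) simp
    show "coeff ([:x $ i, b $ i:] ^ k) k = (b $ i) ^ k"
      using coeff_prod_degree_bound(2)[of "{..<k}" "\<lambda>_. [:x $ i, b $ i:]" "\<lambda>_. 1"] by simp
  qed
  have q: "degree (q m) \<le> p \<and> coeff (q m) p = (\<Prod>i\<in>UNIV. (b $ i) ^ Poly_Mapping.lookup m i)"
    if "m \<in> Poly_Mapping.keys f" for m
  proof -
    have "(\<Sum>i\<in>UNIV. Poly_Mapping.lookup m i) = p"
      using hom that by (simp add: homogeneous_mpoly_def)
    then show ?thesis
      using coeff_prod_degree_bound[of UNIV "\<lambda>i. [:x $ i, b $ i:] ^ Poly_Mapping.lookup m i"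
          "Poly_Mapping.lookup m"] lin
      by (simp add: q_def)
  qed
  have "degree P \<le> p"
    unfolding P_def using q by (intro degree_sum_le) (auto intro: degree_smult_le[THEN order_trans])
  moreover have cP: "coeff P p = mpoly_eval f b"
    unfolding P_def mpoly_eval_def using q by (simp add: coeff_sum cong: sum.cong)
  ultimately have deg: "degree P = p"
    using nz le_degree[of P p] by force
  have "P \<noteq> 0"
    using cP nz by auto
  then obtain R where R: "size R = degree P" "P = smult (lead_coeff P) (\<Prod>r\<in>#R. [:-r, 1:])"
    using alg_closed_imp_factorization by blast
  have "mpoly_eval f (x + s *s b) = poly P s" for s
    by (simp add: P_def q_def mpoly_eval_def poly_sum poly_prod mult.commute)
  moreover have "poly (\<Prod>r\<in>#R. [:-r, 1:]) s = (\<Prod>r\<in>#R. s - r)" for s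
  proof (induction R)
    case (add r R)
    have "poly ([:-r, 1:] * Q) s = (s - r) * poly Q s" for Q
      by (simp add: algebra_simps)
    with add show ?case
      by (simp only: image_mset_add_mset prod_mset.add_mset)
  qed simp
  ultimately have "mpoly_eval f (x + s *s b) = mpoly_eval f b * (\<Prod>r\<in>#R. s - r)" for s
    using R(2) cP deg by (metis poly_smult)
  with R(1) deg that show thesis by metis
qed

text \<open>
  A quantitative substitute for the continuity of roots (Hurwitz' theorem).
\<close>

lemma mpoly_eval_lower_bound:
  fixes x b :: "complex ^ 'n::finite"
  assumes hom: "homogeneous_mpoly p f" and \<delta>: "0 < \<delta>"
    and far: "\<And>s. mpoly_eval f (x + s *s b) = 0 \<Longrightarrow> \<delta> \<le> norm (s\<^sub>0 - s)"
  shows "norm (mpoly_eval f b) * \<delta> ^ p \<le> norm (mpoly_eval f (x + s\<^sub>0 *s b))"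
proof (cases "mpoly_eval f b = 0")
  case False
  obtain R where R: "size R = p" "\<And>s. mpoly_eval f (x + s *s b) = mpoly_eval f b * (\<Prod>r\<in>#R. s - r)"
    using mpoly_eval_line_factorization[OF hom False, of x] by metis
  \<comment> \<open>The induction runs over submultisets of \<open>R\<close>, so that each new
    factor still belongs to a zero on the line and \<open>far\<close> applies to it.\<close>
  have "\<delta> ^ size Q \<le> norm (\<Prod>r\<in>#Q. s\<^sub>0 - r)" if "Q \<subseteq># R" for Q
    using that
  proof (induction Q)
    case (add r Q)
    have "r \<in># R"
      using add.prems by (rule mset_subset_eqD) simp
    have "Q \<subseteq># R"
      by (rule subset_mset.order_trans[OF _ add.prems]) simp
    from \<open>r \<in># R\<close> have "\<delta> \<le> norm (s\<^sub>0 - r)"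
      by (intro far) (auto simp: R)
    with add.IH[OF \<open>Q \<subseteq># R\<close>] \<delta> show ?case
      by (simp add: norm_mult mult_mono)
  qed simp
  from this[of R] show ?thesis
    by (simp add: R norm_mult mult_left_mono)
qed simp

subsection \<open>The hyperbolicity cone\<close>

lemma hyperbolic_mpoly_iff:
  "hyperbolic_mpoly p f a \<longleftrightarrow> homogeneous_mpoly p f \<and> mpoly_eval f a \<noteq> 0 \<and>
     (\<forall>x t. mpoly_eval f (complexify x + t *s complexify a) = 0 \<longrightarrow> t \<in> \<real>)"
proof -
  have "(\<chi> i. of_real (x $ i) + t * of_real (a $ i)) = complexify x + t *s complexify a" for x t
    by (simp add: complexify_def vec_eq_iff)
  then show ?thesis
    by (simp add: hyperbolic_mpoly_def)
qed

lemma mpoly_eval_complexify_real_line: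
  "mpoly_eval f (complexify x + of_real r *s complexify a) = of_real (mpoly_eval f (x + r *\<^sub>R a))"
  using mpoly_eval_complexify[of f "x + r *\<^sub>R a"]
  by (simp add: complexify_add complexify_scale scalar_mult_eq_scaleR flip: scalar_mult_eq_scaleR)

lemma mpoly_eval_scaleR:
  "homogeneous_mpoly p f \<Longrightarrow> mpoly_eval f (c *\<^sub>R x) = c ^ p * mpoly_eval f x"
  using mpoly_eval_scale[of p f c x] by (simp add: scalar_mult_eq_scaleR)

text \<open>Rescaling \<theta> + t a by 1 / (1 + t) sweeps out the segment without its end
  \<open>a\<close>, and homogeneity makes the rescaling harmless. The segment condition thus becomes
  the absence of nonnegative roots along \<open>a\<close>.\<close>

lemma segment_nonzero_iff_ray_nonzero:
  fixes a \<theta> :: "real ^ 'n::finite"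
  assumes hom: "homogeneous_mpoly p f" and a: "mpoly_eval f a \<noteq> 0"
  shows "closed_segment a \<theta> \<subseteq> {x. mpoly_eval f x \<noteq> 0} \<longleftrightarrow>
         (\<forall>t\<ge>0. mpoly_eval f (\<theta> + t *\<^sub>R a) \<noteq> 0)"
proof (intro iffI allI impI subsetI)
  fix t :: real
  assume seg: "closed_segment a \<theta> \<subseteq> {x. mpoly_eval f x \<noteq> 0}" and t: "0 \<le> t"
  have "inverse (1 + t) *\<^sub>R (\<theta> + t *\<^sub>R a) = (1 - inverse (1 + t)) *\<^sub>R a + inverse (1 + t) *\<^sub>R \<theta>"
  proof -
    have "inverse (1 + t) * t = 1 - inverse (1 + t)"
      using t by (simp add: field_simps)
    then show ?thesis
      by (simp only: scaleR_right_distrib scaleR_scaleR add.commute)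
  qed
  then have "inverse (1 + t) *\<^sub>R (\<theta> + t *\<^sub>R a) \<in> closed_segment a \<theta>"
    unfolding in_segment using t
    by (intro exI[of _ "inverse (1 + t)"]) (simp add: inverse_le_1_iff)
  with seg have "mpoly_eval f (inverse (1 + t) *\<^sub>R (\<theta> + t *\<^sub>R a)) \<noteq> 0"
    by blast
  then show "mpoly_eval f (\<theta> + t *\<^sub>R a) \<noteq> 0"
    unfolding mpoly_eval_scaleR[OF hom] by simp
next
  fix x
  assume ray: "\<forall>t\<ge>0. mpoly_eval f (\<theta> + t *\<^sub>R a) \<noteq> 0" and "x \<in> closed_segment a \<theta>"
  then obtain u where u: "0 \<le> u" "u \<le> 1" "x = (1 - u) *\<^sub>R a + u *\<^sub>R \<theta>"
    by (auto simp: in_segment)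
  show "x \<in> {x. mpoly_eval f x \<noteq> 0}"
  proof (cases "u = 0")
    case True
    then show ?thesis using u a by simp
  next
    case False
    then have "x = u *\<^sub>R (\<theta> + ((1 - u) / u) *\<^sub>R a)"
      using u by (simp add: scaleR_right_distrib)
    then show ?thesis
      using ray u False by (simp add: mpoly_eval_scaleR[OF hom])
  qed
qed

text \<open>A compact segment has positive distance from the closed complement of \<open>S\<close>,
  and moving the end \<theta> moves no point of the segment by more than that.\<close>

lemma open_segments_within_open:
  fixes a :: "'a::euclidean_space"
  assumes "open S"
  shows "open {\<theta>. closed_segment a \<theta> \<subseteq> S}"
proof (rule openI)
  fix \<theta> assume "\<theta> \<in> {\<theta>. closed_segment a \<theta> \<subseteq> S}"
  then obtain d where d: "d > 0" "\<And>x y. x \<in> closed_segment a \<theta> \<Longrightarrow> y \<in> - S \<Longrightarrow> d \<le> dist x y"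
    using separate_compact_closed[of "closed_segment a \<theta>" "- S"] assms by force
  have "closed_segment a \<theta>' \<subseteq> S" if \<theta>': "dist \<theta> \<theta>' < d" for \<theta>'
  proof
    fix y assume "y \<in> closed_segment a \<theta>'"
    then obtain u where u: "0 \<le> u" "u \<le> 1" "y = (1 - u) *\<^sub>R a + u *\<^sub>R \<theta>'"
      by (auto simp: in_segment)
    have "dist ((1 - u) *\<^sub>R a + u *\<^sub>R \<theta>) y = u * dist \<theta> \<theta>'"
      using u by (simp add: dist_norm flip: scaleR_diff_right)
    also have "\<dots> \<le> dist \<theta> \<theta>'"
      using u by (simp add: mult_left_le_one_le)
    finally have "dist ((1 - u) *\<^sub>R a + u *\<^sub>R \<theta>) y < d"
      using \<theta>' by simp
    moreover have "(1 - u) *\<^sub>R a + u *\<^sub>R \<theta> \<in> closed_segment a \<theta>"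
      using u by (auto simp: in_segment)
    ultimately show "y \<in> S"
      using d(2) by force
  qed
  then have "ball \<theta> d \<subseteq> {\<theta>. closed_segment a \<theta> \<subseteq> S}"
    by (metis mem_Collect_eq mem_ball subsetI)
  with d(1) show "\<exists>e>0. ball \<theta> e \<subseteq> {\<theta>. closed_segment a \<theta> \<subseteq> S}"
    by blast
qed

lemma open_mpoly_eval_nonzero: "open {x :: real ^ 'n::finite. mpoly_eval f x \<noteq> 0}"
  by (intro open_Collect_neq continuous_intros)

text \<open>The set \<open>G\<close> of points joined to \<open>a\<close> by a zero-free segment is
  open, and inside the nonzero set it agrees with the closed set \<open>D\<close>: for a point of
  \<open>G\<close> all roots along \<open>a\<close> are real and negative, hence at distance at
  least \<open>t\<close> from any \<open>t > 0\<close>. So \<open>G\<close> cuts out a nonempty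
  clopen part of the component of \<open>a\<close>, which is all of it.\<close>

lemma hyperbolicity_cone_eq_segments:
  fixes f :: "'n::finite real_mpoly"
  assumes hyp: "hyperbolic_mpoly p f a"
  shows "hyperbolicity_cone f a = {\<theta>. closed_segment a \<theta> \<subseteq> {x. mpoly_eval f x \<noteq> 0}}"
proof
  define S where "S = {x :: real ^ 'n. mpoly_eval f x \<noteq> 0}"
  define G where "G = {\<theta>. closed_segment a \<theta> \<subseteq> S}"
  define D where "D = {\<theta>. \<forall>t>0. \<bar>mpoly_eval f a\<bar> * t ^ p \<le> \<bar>mpoly_eval f (\<theta> + t *\<^sub>R a)\<bar>}"
  define C where "C = connected_component_set S a"
  have hom: "homogeneous_mpoly p f" and a: "mpoly_eval f a \<noteq> 0"
    and real: "\<And>x t. mpoly_eval f (complexify x + t *s complexify a) = 0 \<Longrightarrow> t \<in> \<real>"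
    using hyp by (auto simp: hyperbolic_mpoly_iff)
  have ray: "\<theta> \<in> G \<longleftrightarrow> (\<forall>t\<ge>0. mpoly_eval f (\<theta> + t *\<^sub>R a) \<noteq> 0)" for \<theta>
    unfolding G_def S_def using segment_nonzero_iff_ray_nonzero[OF hom a] by simp
  have C: "connected C" "C \<subseteq> S" "a \<in> C"
    using a by (auto simp: C_def S_def connected_component_subset)
  have "G \<subseteq> D"
  proof
    fix \<theta> assume \<theta>: "\<theta> \<in> G"
    have "\<bar>mpoly_eval f a\<bar> * t ^ p \<le> \<bar>mpoly_eval f (\<theta> + t *\<^sub>R a)\<bar>" if "t > 0" for t
    proof -
      have "norm (mpoly_eval f (complexify a)) * t ^ p
          \<le> norm (mpoly_eval f (complexify \<theta> + of_real t *s complexify a))"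
      proof (rule mpoly_eval_lower_bound[OF hom \<open>t > 0\<close>])
        fix s assume s: "mpoly_eval f (complexify \<theta> + s *s complexify a) = 0"
        then obtain r where r: "s = of_real r"
          using real by (metis Reals_cases)
        then have "mpoly_eval f (\<theta> + r *\<^sub>R a) = 0"
          using s by (simp add: mpoly_eval_complexify_real_line)
        then have "r < 0"
          using \<theta> ray by (meson not_le)
        then show "t \<le> norm (of_real t - s)"
          using r \<open>t > 0\<close> by (simp flip: of_real_diff)
      qed
      then show ?thesis
        by (simp add: mpoly_eval_complexify_real_line mpoly_eval_complexify)
    qed
    then show "\<theta> \<in> D" by (simp add: D_def)
  qed
  moreover have "D \<inter> S \<subseteq> G"
  proof
    fix \<theta> assume \<theta>: "\<theta> \<in> D \<inter> S"
    have "mpoly_eval f (\<theta> + t *\<^sub>R a) \<noteq> 0" if "t \<ge> 0" for t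
    proof (cases "t = 0")
      case False
      with that have "0 < \<bar>mpoly_eval f a\<bar> * t ^ p"
        using a by simp
      also have "\<dots> \<le> \<bar>mpoly_eval f (\<theta> + t *\<^sub>R a)\<bar>"
        using \<theta> that False by (simp add: D_def)
      finally show ?thesis by simp
    qed (use \<theta> in \<open>simp add: S_def\<close>)
    then show "\<theta> \<in> G" by (simp add: ray)
  qed
  ultimately have "C \<inter> G = C \<inter> D"
    using C(2) by blast
  moreover have "closed D"
  proof -
    have "D = (\<Inter>t\<in>{0<..}. {\<theta>. \<bar>mpoly_eval f a\<bar> * t ^ p \<le> \<bar>mpoly_eval f (\<theta> + t *\<^sub>R a)\<bar>})"
      by (auto simp: D_def)
    also have "closed \<dots>"
      by (intro closed_INT ballI closed_Collect_le continuous_intros)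
    finally show ?thesis .
  qed
  ultimately have "closedin (top_of_set C) (C \<inter> G)"
    by (metis closedin_closed_Int)
  moreover have "open G"
    unfolding G_def S_def by (intro open_segments_within_open open_mpoly_eval_nonzero)
  then have "openin (top_of_set C) (C \<inter> G)"
    by (metis openin_open_Int)
  moreover have "a \<in> C \<inter> G"
    using C a by (simp add: G_def S_def)
  ultimately have "C \<inter> G = C"
    using C(1) unfolding connected_clopen by blast
  then show "hyperbolicity_cone f a \<subseteq> {\<theta>. closed_segment a \<theta> \<subseteq> {x. mpoly_eval f x \<noteq> 0}}"
    unfolding C_def G_def S_def hyperbolicity_cone_def by blast
  have "closed_segment a \<theta> \<subseteq> C" if "closed_segment a \<theta> \<subseteq> S" for \<theta>
    unfolding C_def using that by (intro connected_component_maximal) auto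
  then show "{\<theta>. closed_segment a \<theta> \<subseteq> {x. mpoly_eval f x \<noteq> 0}} \<subseteq> hyperbolicity_cone f a"
    unfolding C_def S_def hyperbolicity_cone_def using ends_in_segment(2) by blast
qed

section \<open>Hyperbolicity in every direction of the cone\<close>

lemma mpoly_eval_root_bound:
  fixes b :: "complex ^ 'n::finite"
  assumes hom: "homogeneous_mpoly p f" and b: "mpoly_eval f b \<noteq> 0"
  obtains R where "\<And>y s. norm y \<le> B \<Longrightarrow> mpoly_eval f (y + s *s b) = 0 \<Longrightarrow> norm s \<le> R"
proof -
  have "open {z. mpoly_eval f (b + z) \<noteq> 0}"
    by (intro open_Collect_neq continuous_intros)
  moreover have "0 \<in> {z. mpoly_eval f (b + z) \<noteq> 0}"
    using b by simp
  ultimately obtain \<delta> where "\<delta> > 0" "ball 0 \<delta> \<subseteq> {z. mpoly_eval f (b + z) \<noteq> 0}"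
    by (rule openE)
  then have \<delta>: "\<delta> > 0" "\<And>z. norm z < \<delta> \<Longrightarrow> mpoly_eval f (b + z) \<noteq> 0"
    by (auto simp: subset_eq)
  have "norm s \<le> max 0 (B / \<delta>)" if y: "norm y \<le> B" and 0: "mpoly_eval f (y + s *s b) = 0" for y s
  proof (rule ccontr)
    assume "\<not> norm s \<le> max 0 (B / \<delta>)"
    then have s: "s \<noteq> 0" "B < norm s * \<delta>"
      using \<delta>(1) by (auto simp: pos_divide_less_eq not_le)
    \<comment> \<open>Dividing by \<open>s\<close> produces a zero of \<open>f\<close> at distance
      \<open>norm y / norm s\<close> from \<open>b\<close>, too close to \<open>b\<close> when
      \<open>s\<close> is large.\<close>
    have "y + s *s b = s *s (b + (1 / s) *s y)"
      using s by (simp add: vec_eq_iff field_simps)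
    with 0 have "mpoly_eval f (s *s (b + (1 / s) *s y)) = 0"
      by (simp only:)
    with s have "mpoly_eval f (b + (1 / s) *s y) = 0"
      unfolding mpoly_eval_scale[OF hom] by simp
    moreover have "norm ((1 / s) *s y) < \<delta>"
      using y s by (simp add: norm_vector_scalar_mult norm_divide field_simps)
    ultimately show False
      using \<delta>(2) by blast
  qed
  with that show thesis by blast
qed

text \<open>
  Garding's homotopy: as \<open>u\<close> runs from 0 to 1, the roots \<open>s\<close> of \<open>f (u x + i a + s b)\<close> never
  become real, so they stay in the half-plane where they lie for \<open>u = 0\<close>.
\<close>

lemma hyperbolic_mpoly_root_half_plane:
  assumes hyp: "hyperbolic_mpoly p f a" and b: "b \<in> hyperbolicity_cone f a"
    and root: "mpoly_eval f (complexify x + \<i> *s complexify a + s *s complexify b) = 0"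
  shows "Im s < 0"
proof -
  have hom: "homogeneous_mpoly p f" and a: "mpoly_eval f a \<noteq> 0"
    and real: "\<And>x t. mpoly_eval f (complexify x + t *s complexify a) = 0 \<Longrightarrow> t \<in> \<real>"
    using hyp by (auto simp: hyperbolic_mpoly_iff)
  have ray: "\<And>t. t \<ge> 0 \<Longrightarrow> mpoly_eval f (b + t *\<^sub>R a) \<noteq> 0"
    using b segment_nonzero_iff_ray_nonzero[OF hom a, of b]
    by (simp add: hyperbolicity_cone_eq_segments[OF hyp])
  from ray[of 0] have fb: "mpoly_eval f b \<noteq> 0" by simp
  define Y where "Y u = of_real u *s complexify x + \<i> *s complexify a" for u :: real
  define E where "E u s = mpoly_eval f (Y u + s *s complexify b)" for u s
  define T where "T = {u \<in> {0..1}. \<forall>s. E u s = 0 \<longrightarrow> Im s < 0}"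
  \<comment> \<open>For real \<open>s\<close> the point u x + s b is real, so \<i> would be a root
    along \<open>a\<close>, against hyperbolicity.\<close>
  have Im_nz: "Im s \<noteq> 0" if "E u s = 0" for u s
  proof
    assume "Im s = 0"
    then obtain r where "s = of_real r"
      by (metis complex_is_Real_iff Reals_cases)
    then have "Y u + s *s complexify b = complexify (u *s x + r *s b) + \<i> *s complexify a"
      by (simp add: Y_def complexify_add complexify_scale)
    with that real have "\<i> \<in> \<real>"
      unfolding E_def by metis
    then show False
      by (simp add: complex_is_Real_iff)
  qed
  have "0 \<in> T"
  proof -
    have "Im s < 0" if 0: "E 0 s = 0" for s
    proof -
      have "s \<noteq> 0"
      proof
        assume "s = 0"
        with 0 have "mpoly_eval f (\<i> *s complexify a) = 0"
          by (simp add: E_def Y_def)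
        with a show False
          by (simp add: mpoly_eval_scale[OF hom] mpoly_eval_complexify)
      qed
      \<comment> \<open>At u = 0, homogeneity turns \<open>s\<close> into the root \<i> / s of f (b
        + t a). It is real and, as \<open>b\<close> lies in the cone, negative.\<close>
      then have "Y 0 + s *s complexify b = s *s (complexify b + (\<i> / s) *s complexify a)"
        by (simp add: Y_def vec_eq_iff field_simps)
      with 0 have "mpoly_eval f (s *s (complexify b + (\<i> / s) *s complexify a)) = 0"
        by (simp only: E_def)
      with \<open>s \<noteq> 0\<close> have 1: "mpoly_eval f (complexify b + (\<i> / s) *s complexify a) = 0"
        unfolding mpoly_eval_scale[OF hom] by simp
      then obtain r where r: "\<i> / s = of_real r"
        by (metis real Reals_cases)
      with 1 have "mpoly_eval f (b + r *\<^sub>R a) = 0"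
        by (simp add: mpoly_eval_complexify_real_line)
      then have "r < 0"
        using ray by (meson not_le)
      moreover have "s = \<i> / of_real r"
        using r \<open>s \<noteq> 0\<close> \<open>r < 0\<close> by (simp add: field_simps)
      ultimately show ?thesis
        by (simp add: Im_divide_of_real)
    qed
    then show ?thesis by (simp add: T_def)
  qed
  moreover have "closed T"
  proof -
    \<comment> \<open>If all roots lie below the real axis, a point \<open>s\<close> above it has
      distance at least \<open>Im s\<close> from each, which gives a closed condition on
      \<open>u\<close>. Conversely the positive lower bound excludes roots above the axis, and
      \<open>Im_nz\<close> excludes roots on it.\<close>
    define c where "c s = norm (mpoly_eval f (complexify b)) * Im s ^ p" for s
    have c_pos: "c s > 0" if "Im s > 0" for s
      using fb that by (simp add: c_def mpoly_eval_complexify)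
    have "T = {0..1} \<inter> (\<Inter>s\<in>{s. Im s > 0}. {u. c s \<le> norm (E u s)})"
    proof (intro equalityI subsetI IntI INT_I)
      fix u s assume u: "u \<in> T" and s: "s \<in> {s. Im s > 0}"
      have "Im s \<le> norm (s - s')" if "E u s' = 0" for s'
        using u that abs_Im_le_cmod[of "s - s'"] by (force simp: T_def)
      with mpoly_eval_lower_bound[OF hom, of "Im s"] s show "u \<in> {u. c s \<le> norm (E u s)}"
        by (simp add: E_def c_def)
    next
      fix u assume u: "u \<in> {0..1} \<inter> (\<Inter>s\<in>{s. Im s > 0}. {u. c s \<le> norm (E u s)})"
      have "Im s < 0" if "E u s = 0" for s
      proof (rule ccontr)
        assume "\<not> Im s < 0"
        with Im_nz[OF that] have "Im s > 0" by simp
        with u that c_pos[of s] show False by force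
      qed
      with u show "u \<in> T" by (simp add: T_def)
    qed (auto simp: T_def)
    also have "closed \<dots>"
      unfolding E_def Y_def
      by (intro closed_Int closed_INT ballI closed_Collect_le continuous_intros closed_atLeastAtMost)
    finally show ?thesis .
  qed
  moreover have "closed ({0..1} - T)"
  proof -
    define B where "B = norm (complexify x) + norm (complexify a)"
    obtain R where R: "\<And>y s. norm y \<le> B \<Longrightarrow> mpoly_eval f (y + s *s complexify b) = 0 \<Longrightarrow> norm s \<le> R"
      using mpoly_eval_root_bound[OF hom, of "complexify b" B] fb by (auto simp: mpoly_eval_complexify)
    have "norm (Y u) \<le> B" if "u \<in> {0..1}" for u
      unfolding Y_def B_def using that
      by (intro norm_triangle_mono) (auto simp: norm_vector_scalar_mult mult_left_le_one_le)
    with R have R': "norm s \<le> R" if "u \<in> {0..1}" "E u s = 0" for u s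
      using that by (auto simp: E_def)
    \<comment> \<open>The parameters outside \<open>T\<close> are the projection of a compact set of
      pairs, because the roots are bounded uniformly in \<open>u\<close>.\<close>
    define Z where "Z = ({0..1} \<times> cball 0 R) \<inter> {z. Im (snd z) \<ge> 0} \<inter> {z. E (fst z) (snd z) = 0}"
    have "compact Z"
      unfolding Z_def E_def Y_def
      by (intro compact_Int_closed compact_Times closed_Collect_le closed_Collect_eq continuous_intros)
        auto
    then have "compact (fst ` Z)"
      by (intro compact_continuous_image continuous_intros)
    moreover have "fst ` Z = {0..1} - T"
    proof (intro equalityI subsetI)
      fix u assume "u \<in> {0..1} - T"
      then obtain s where "u \<in> {0..1}" "E u s = 0" "Im s \<ge> 0"
        by (auto simp: T_def not_less)
      then have "(u, s) \<in> Z"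
        using R' by (simp add: Z_def)
      then show "u \<in> fst ` Z"
        by (metis fst_conv image_eqI)
    qed (auto simp: Z_def T_def not_less)
    ultimately show ?thesis
      by (simp add: compact_imp_closed)
  qed
  moreover have "T \<union> ({0..1} - T) = {0..1}" "T \<inter> ({0..1} - T) = {}"
    by (auto simp: T_def)
  ultimately have "{0..1} - T = {}"
    using connected_closed_set[of "{0..1::real}"] by (metis closed_atLeastAtMost connected_Icc empty_iff)
  then have "1 \<in> T" by auto
  with root show ?thesis
    by (simp add: T_def E_def Y_def)
qed

text \<open>Adding \<i> \<epsilon> a to the real point and rescaling by 1 / \<epsilon> places all
  roots in the lower half-plane. The resulting lower bound on \<open>f\<close> survives \<epsilon> =
  0 by closedness and excludes roots in the upper half-plane; replacing x and s by their negatives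
  excludes the lower one.\<close>

lemma hyperbolic_mpoly_cone_direction:
  assumes hyp: "hyperbolic_mpoly p f a" and b: "b \<in> hyperbolicity_cone f a"
  shows "hyperbolic_mpoly p f b"
proof -
  have hom: "homogeneous_mpoly p f"
    using hyp by (auto simp: hyperbolic_mpoly_iff)
  have fb: "mpoly_eval f b \<noteq> 0"
    using b unfolding hyperbolicity_cone_def by (auto dest: connected_component_in)
  have upper: "Im s \<le> 0" if 0: "mpoly_eval f (complexify x + s *s complexify b) = 0" for x s
  proof (rule ccontr)
    assume "\<not> Im s \<le> 0"
    then have pos: "Im s > 0" by simp
    define g where "g \<epsilon> = mpoly_eval f ((complexify x + (of_real \<epsilon> * \<i>) *s complexify a) + s *s complexify b)"
      for \<epsilon> :: real
    define c where "c = norm (mpoly_eval f (complexify b)) * Im s ^ p"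
    have "c \<le> norm (g \<epsilon>)" if "\<epsilon> > 0" for \<epsilon>
      unfolding c_def g_def
    proof (rule mpoly_eval_lower_bound[OF hom pos])
      fix s' assume 0: "mpoly_eval f (complexify x + (of_real \<epsilon> * \<i>) *s complexify a + s' *s complexify b) = 0"
      have "complexify x + (of_real \<epsilon> * \<i>) *s complexify a + s' *s complexify b
          = of_real \<epsilon> *s (complexify ((1 / \<epsilon>) *s x) + \<i> *s complexify a + (s' / of_real \<epsilon>) *s complexify b)"
        using that by (simp add: complexify_scale vec_eq_iff field_simps)
      with 0 have "mpoly_eval f (of_real \<epsilon> *s (complexify ((1 / \<epsilon>) *s x) + \<i> *s complexify a
          + (s' / of_real \<epsilon>) *s complexify b)) = 0"
        by (simp only:)
      with that have "mpoly_eval f (complexify ((1 / \<epsilon>) *s x) + \<i> *s complexify a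
          + (s' / of_real \<epsilon>) *s complexify b) = 0"
        unfolding mpoly_eval_scale[OF hom] by simp
      then have "Im (s' / of_real \<epsilon>) < 0"
        by (rule hyperbolic_mpoly_root_half_plane[OF hyp b])
      with that have "Im s' < 0"
        by (simp add: divide_less_0_iff)
      then show "Im s \<le> norm (s - s')"
        using abs_Im_le_cmod[of "s - s'"] by simp
    qed
    then have "{0<..} \<subseteq> {\<epsilon>. c \<le> norm (g \<epsilon>)}"
      by auto
    moreover have "closed {\<epsilon>. c \<le> norm (g \<epsilon>)}"
      unfolding g_def by (intro closed_Collect_le continuous_intros)
    ultimately have "closure {0<..} \<subseteq> {\<epsilon>. c \<le> norm (g \<epsilon>)}"
      by (rule closure_minimal)
    then have "c \<le> norm (g 0)"
      by auto
    moreover have "c > 0"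
      using pos fb by (simp add: c_def mpoly_eval_complexify)
    ultimately show False
      using 0 by (simp add: g_def)
  qed
  have "s \<in> \<real>" if 0: "mpoly_eval f (complexify x + s *s complexify b) = 0" for x s
  proof -
    have "complexify ((-1) *s x) + (- s) *s complexify b = (-1) *s (complexify x + s *s complexify b)"
      by (simp add: complexify_def vec_eq_iff)
    then have "mpoly_eval f (complexify ((-1) *s x) + (- s) *s complexify b) = 0"
      using 0 by (simp only: mpoly_eval_scale[OF hom]) simp
    from upper[OF this] upper[OF 0] show ?thesis
      by (simp add: complex_is_Real_iff)
  qed
  with hom fb show ?thesis
    by (auto simp: hyperbolic_mpoly_iff)
qed

subsection \<open>The logarithmic gradient\<close>

text \<open>The polynomial f (v + t b) has degree exactly \<open>p\<close> in \<open>t\<close> and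
  real roots; substituting t = 1 / s and using homogeneity reverses it. A root at 0 becomes \<mu> j
  = 0, so there are always \<open>p\<close> factors even if the degree in \<open>s\<close>
  drops.\<close>

lemma hyperbolic_mpoly_line_factorization:
  assumes hyp: "hyperbolic_mpoly p f b"
  obtains \<mu> :: "nat \<Rightarrow> real"
    where "\<And>s. mpoly_eval f (b + s *\<^sub>R v) = mpoly_eval f b * (\<Prod>j<p. 1 + s * \<mu> j)"
proof -
  have hom: "homogeneous_mpoly p f" and fb: "mpoly_eval f b \<noteq> 0"
    and real: "\<And>x t. mpoly_eval f (complexify x + t *s complexify b) = 0 \<Longrightarrow> t \<in> \<real>"
    using hyp by (auto simp: hyperbolic_mpoly_iff)
  have "mpoly_eval f (complexify b) \<noteq> 0"
    using fb by (simp add: mpoly_eval_complexify)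
  then obtain R where R: "size R = p" "\<And>s. mpoly_eval f (complexify v + s *s complexify b)
      = mpoly_eval f (complexify b) * (\<Prod>r\<in>#R. s - r)"
    using mpoly_eval_line_factorization[OF hom] by metis
  obtain rs where rs: "mset rs = R"
    using ex_mset by blast
  have len: "length rs = p"
    using R(1) rs by (metis size_mset)
  define \<mu> where "\<mu> j = - Re (rs ! j)" for j
  have prod: "(\<Prod>r\<in>#R. s - r) = (\<Prod>j<p. s - rs ! j)" for s
    unfolding rs[symmetric] mset_map[symmetric] prod_mset_prod_list prod.list_conv_set_nth
    by (simp add: len atLeast0LessThan)
  have \<mu>: "rs ! j = of_real (- \<mu> j)" if "j < p" for j
  proof -
    have "(\<Prod>i<p. rs ! j - rs ! i) = 0"
      using that by auto
    then have "mpoly_eval f (complexify v + rs ! j *s complexify b) = 0"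
      unfolding R(2) prod by simp
    then have "rs ! j \<in> \<real>"
      by (rule real)
    then show ?thesis
      by (simp add: \<mu>_def)
  qed
  have v: "mpoly_eval f (v + t *\<^sub>R b) = mpoly_eval f b * (\<Prod>j<p. t + \<mu> j)" for t
  proof -
    have "complex_of_real (mpoly_eval f (v + t *\<^sub>R b)) = of_real (mpoly_eval f b) * (\<Prod>j<p. of_real t - rs ! j)"
      using R(2)[of "of_real t"] by (simp add: mpoly_eval_complexify_real_line mpoly_eval_complexify prod)
    also have "\<dots> = of_real (mpoly_eval f b * (\<Prod>j<p. t + \<mu> j))"
      by (simp add: \<mu>)
    finally show ?thesis
      by (simp only: of_real_eq_iff)
  qed
  have "mpoly_eval f (b + s *\<^sub>R v) = mpoly_eval f b * (\<Prod>j<p. 1 + s * \<mu> j)" for s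
  proof (cases "s = 0")
    case False
    then have "b + s *\<^sub>R v = s *\<^sub>R (v + (1 / s) *\<^sub>R b)"
      by (simp add: scaleR_right_distrib)
    then have "mpoly_eval f (b + s *\<^sub>R v) = mpoly_eval f b * (s ^ p * (\<Prod>j<p. 1 / s + \<mu> j))"
      by (simp add: mpoly_eval_scaleR[OF hom] v)
    also have "s ^ p * (\<Prod>j<p. 1 / s + \<mu> j) = (\<Prod>j<p. s * (1 / s + \<mu> j))"
      by (simp add: prod.distrib)
    also have "\<dots> = (\<Prod>j<p. 1 + s * \<mu> j)"
      using False by (simp add: distrib_left)
    finally show ?thesis .
  qed simp
  with that show thesis by blast
qed

abbreviation (input) log_gradient :: "'n::finite real_mpoly \<Rightarrow> real ^ 'n \<Rightarrow> real ^ 'n" where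
  "log_gradient f \<equiv> gradient (\<lambda>\<theta>. ln (mpoly_eval f \<theta>))"

lemma log_gradient:
  assumes "mpoly_eval f x > 0"
  shows "log_gradient f x = (1 / mpoly_eval f x) *\<^sub>R gradient (mpoly_eval f) x"
    and "GDERIV (\<lambda>\<theta>. ln (mpoly_eval f \<theta>)) x :> log_gradient f x"
    and "GDERIV (mpoly_eval f) x :> mpoly_eval f x *\<^sub>R log_gradient f x"
proof -
  obtain D where D: "GDERIV (mpoly_eval f) x :> D"
    using mpoly_eval_GDERIV by blast
  have ln: "GDERIV (\<lambda>\<theta>. ln (mpoly_eval f \<theta>)) x :> (1 / mpoly_eval f x) *\<^sub>R D"
    using assms by (auto intro!: GDERIV_DERIV_compose[OF D] derivative_eq_intros)
  then show "GDERIV (\<lambda>\<theta>. ln (mpoly_eval f \<theta>)) x :> log_gradient f x"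
    and "log_gradient f x = (1 / mpoly_eval f x) *\<^sub>R gradient (mpoly_eval f) x"
    and "GDERIV (mpoly_eval f) x :> mpoly_eval f x *\<^sub>R log_gradient f x"
    using gradient_eqI[OF ln] gradient_eqI[OF D] D assms by auto
qed

lemma has_field_derivative_prod_linear_at_0:
  "((\<lambda>s. \<Prod>j\<in>I. 1 + s * \<mu> j) has_field_derivative (\<Sum>j\<in>I. \<mu> j)) (at 0)"
  for \<mu> :: "'a \<Rightarrow> real"
proof (cases "finite I")
  case True
  then show ?thesis
    by (induction I) (auto intro!: derivative_eq_intros)
qed simp

text \<open>Both sides of \<open>fac\<close> are differentiated at s = 0, and the common factor
  \<open>f b\<close> is cancelled.\<close>

lemma inner_log_gradient_eq_sum:
  assumes pos: "mpoly_eval f b > 0"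
    and fac: "\<And>s. mpoly_eval f (b + s *\<^sub>R v) = mpoly_eval f b * (\<Prod>j<p. 1 + s * \<mu> j)"
  shows "v \<bullet> log_gradient f b = (\<Sum>j<p. \<mu> j)"
proof -
  have line: "((\<lambda>s. b + s *\<^sub>R v) has_derivative (\<lambda>s. s *\<^sub>R v)) (at 0)"
    by (auto intro!: derivative_eq_intros)
  have "(mpoly_eval f has_derivative (\<lambda>h. h \<bullet> (mpoly_eval f b *\<^sub>R log_gradient f b)))
      (at (b + 0 *\<^sub>R v))"
    using log_gradient(3)[OF pos] by (simp add: gderiv_def)
  from has_derivative_compose[OF line this] have "((\<lambda>s. mpoly_eval f (b + s *\<^sub>R v)) has_field_derivative
      mpoly_eval f b * (v \<bullet> log_gradient f b)) (at 0)"
    by (rule has_derivative_imp_has_field_derivative) simp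
  moreover have "((\<lambda>s. mpoly_eval f (b + s *\<^sub>R v)) has_field_derivative
      mpoly_eval f b * (\<Sum>j<p. \<mu> j)) (at 0)"
    unfolding fac by (intro DERIV_cmult has_field_derivative_prod_linear_at_0)
  ultimately have "mpoly_eval f b * (v \<bullet> log_gradient f b) = mpoly_eval f b * (\<Sum>j<p. \<mu> j)"
    by (rule DERIV_unique)
  with pos show ?thesis by simp
qed

section \<open>Convexity and closure properties of the cone\<close>

locale hyperbolic =
  fixes p :: nat and f :: "'n::finite real_mpoly" and a :: "real ^ 'n"
  assumes hyp: "hyperbolic_mpoly p f a"
begin

abbreviation C :: "(real ^ 'n) set" where
  "C \<equiv> hyperbolicity_cone f a"

lemma homogeneous: "homogeneous_mpoly p f"
  using hyp by (simp add: hyperbolic_mpoly_iff)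

lemma base_in_cone: "a \<in> C"
  using hyp by (simp add: hyperbolic_mpoly_iff hyperbolicity_cone_def)

lemma nonzero_on_cone: "x \<in> C \<Longrightarrow> mpoly_eval f x \<noteq> 0"
  unfolding hyperbolicity_cone_def by (auto dest: connected_component_in)

lemma open_cone: "open C"
  unfolding hyperbolicity_cone_def by (intro open_connected_component open_mpoly_eval_nonzero)

lemma hyperbolic_cone_direction: "b \<in> C \<Longrightarrow> hyperbolic_mpoly p f b"
  by (rule hyperbolic_mpoly_cone_direction[OF hyp])

text \<open>The component of \<open>a\<close> is also the component of \<open>b\<close>, and
  \<open>f\<close> is hyperbolic at \<open>b\<close>, so the description by segments holds with any
  base point of the cone. Convexity follows from this.\<close>

lemma in_cone_iff_segment:
  assumes "b \<in> C"
  shows "x \<in> C \<longleftrightarrow> closed_segment b x \<subseteq> {x. mpoly_eval f x \<noteq> 0}"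
proof -
  have "hyperbolicity_cone f b = C"
    using assms unfolding hyperbolicity_cone_def by (metis connected_component_eq)
  with hyperbolicity_cone_eq_segments[OF hyperbolic_cone_direction[OF assms]] show ?thesis
    by blast
qed

lemma convex_cone: "convex C"
  unfolding convex_contains_segment
proof (intro ballI subsetI)
  fix x y z assume xy: "x \<in> C" "y \<in> C" and z: "z \<in> closed_segment x y"
  then have "closed_segment x z \<subseteq> closed_segment x y"
    by (simp add: subset_closed_segment)
  with xy show "z \<in> C"
    using in_cone_iff_segment[OF xy(1)] by blast
qed

lemma cone_scaleR:
  assumes x: "x \<in> C" and c: "c > 0"
  shows "c *\<^sub>R x \<in> C"
  unfolding in_cone_iff_segment[OF x]
proof
  fix z assume "z \<in> closed_segment x (c *\<^sub>R x)"
  then obtain u where u: "0 \<le> u" "u \<le> 1" "z = ((1 - u) + u * c) *\<^sub>R x"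
    by (auto simp: in_segment scaleR_left_distrib)
  have "(1 - u) + u * c > 0"
    using u c by (cases "u = 0") (auto intro: add_nonneg_pos)
  then show "z \<in> {x. mpoly_eval f x \<noteq> 0}"
    using nonzero_on_cone[OF x] u by (simp add: mpoly_eval_scaleR[OF homogeneous])
qed

lemma cone_add:
  assumes "x \<in> C" "y \<in> C"
  shows "x + y \<in> C"
proof -
  have "(1 / 2) *\<^sub>R x + (1 / 2) *\<^sub>R y \<in> C"
    using convex_cone assms by (auto intro: convexD)
  then have "2 *\<^sub>R ((1 / 2) *\<^sub>R x + (1 / 2) *\<^sub>R y) \<in> C"
    by (intro cone_scaleR) auto
  then show ?thesis
    by (simp add: scaleR_right_distrib)
qed

text \<open>Approximate \<open>x\<close> by \<open>y\<close> in the cone; the error x - y is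
  absorbed by a ball around \<open>b\<close>.\<close>

lemma cone_add_closure:
  assumes b: "b \<in> C" and x: "x \<in> closure C"
  shows "b + x \<in> C"
proof -
  obtain e where e: "e > 0" "ball b e \<subseteq> C"
    using open_cone b by (meson openE)
  obtain y where y: "y \<in> C" "dist y x < e"
    using x e(1) by (auto simp: closure_approachable)
  have "b + x - y \<in> ball b e"
    using y by (simp add: dist_norm norm_minus_commute)
  then have "(b + x - y) + y \<in> C"
    using e y by (intro cone_add) auto
  then show ?thesis by simp
qed

lemma cone_ray_closure:
  assumes b: "b \<in> C" and x: "x \<in> closure C" and s: "s \<ge> 0"
  shows "b + s *\<^sub>R x \<in> C"
proof (cases "s = 0")
  case False
  with s have "s > 0" by simp
  then have "s *\<^sub>R ((1 / s) *\<^sub>R b + x) \<in> C"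
    using b x by (intro cone_scaleR cone_add_closure) auto
  with False show ?thesis
    by (simp add: scaleR_right_distrib)
qed (use b in simp)

text \<open>A connected component is relatively closed in its ambient set.\<close>

lemma closure_cone_nonzero:
  assumes "x \<in> closure C" "mpoly_eval f x \<noteq> 0"
  shows "x \<in> C"
proof -
  obtain D where D: "closed D" "C = {x. mpoly_eval f x \<noteq> 0} \<inter> D"
    using closedin_connected_component[of "{x. mpoly_eval f x \<noteq> 0}" a]
    unfolding hyperbolicity_cone_def closedin_closed by blast
  then have "closure C \<subseteq> D"
    by (intro closure_minimal) auto
  with D assms show ?thesis by blast
qed

text \<open>A negative \<mu> j would give a zero of \<open>f\<close> at the positive parameter -1 /
  \<mu> j, on a ray that stays in the cone.\<close>

lemma line_roots_nonneg:
  assumes b: "b \<in> C" and x: "x \<in> closure C"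
    and fac: "\<And>s. mpoly_eval f (b + s *\<^sub>R x) = mpoly_eval f b * (\<Prod>j<p. 1 + s * \<mu> j)"
    and j: "j < p"
  shows "\<mu> j \<ge> 0"
proof (rule ccontr)
  assume neg: "\<not> \<mu> j \<ge> 0"
  then have "1 + (- 1 / \<mu> j) * \<mu> j = 0" by simp
  with j have "(\<Prod>i<p. 1 + (- 1 / \<mu> j) * \<mu> i) = 0"
    by (intro prod_zero) auto
  then have "mpoly_eval f (b + (- 1 / \<mu> j) *\<^sub>R x) = 0"
    by (simp only: fac mult_zero_right)
  moreover have "b + (- 1 / \<mu> j) *\<^sub>R x \<in> C"
    using neg by (intro cone_ray_closure b x) (auto simp: field_simps)
  ultimately show False
    using nonzero_on_cone by blast
qed

text \<open>The whole line through \<open>b\<close> lies in the cone. Scaling the point with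
  parameter 1 / e by \<open>e\<close> gives e b + v, which tends to \<open>v\<close> as
  \<open>e\<close> tends to 0.\<close>

lemma line_roots_zero_imp_closure:
  assumes b: "b \<in> C"
    and fac: "\<And>s. mpoly_eval f (b + s *\<^sub>R v) = mpoly_eval f b"
  shows "v \<in> closure C"
proof -
  have line: "b + s *\<^sub>R v \<in> C" for s
    unfolding in_cone_iff_segment[OF b]
  proof
    fix z assume "z \<in> closed_segment b (b + s *\<^sub>R v)"
    then obtain u where "z = (1 - u) *\<^sub>R b + u *\<^sub>R (b + s *\<^sub>R v)"
      by (auto simp: in_segment)
    then have "z = b + (u * s) *\<^sub>R v"
      by (simp add: algebra_simps)
    then show "z \<in> {x. mpoly_eval f x \<noteq> 0}"
      using fac[of "u * s"] nonzero_on_cone[OF b] by simp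
  qed
  have "e *\<^sub>R b + v \<in> C" if "e > 0" for e
    using cone_scaleR[OF line[of "1 / e"] that] that by (simp add: scaleR_right_distrib)
  then have "{0<..} \<subseteq> {e. e *\<^sub>R b + v \<in> closure C}"
    using closure_subset by blast
  moreover have "closed {e. e *\<^sub>R b + v \<in> closure C}"
  proof -
    have "closed ((\<lambda>e. e *\<^sub>R b + v) -` closure C)"
      by (intro closed_vimage closed_closure continuous_intros)
    then show ?thesis by (simp add: vimage_def)
  qed
  ultimately have "closure {0<..} \<subseteq> {e. e *\<^sub>R b + v \<in> closure C}"
    by (rule closure_minimal)
  then show ?thesis by auto
qed

end

section \<open>Consequences of pointedness: positivity and strict monotonicity\<close>

locale complete_hyperbolic_positive = hyperbolic p f a
  for p and f :: "'n::finite real_mpoly" and a +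
  assumes pointed: "pointed_cone C"
    and positive: "\<And>x. x \<in> C \<Longrightarrow> mpoly_eval f x > 0"
begin

text \<open>Constancy of \<open>f\<close> along the line is symmetric in \<open>v\<close>, so both
  \<open>v\<close> and \<open>- v\<close> lie in the closure of the cone.\<close>

lemma line_roots_zero_imp_zero:
  assumes b: "b \<in> C"
    and fac: "\<And>s. mpoly_eval f (b + s *\<^sub>R v) = mpoly_eval f b * (\<Prod>j<p. 1 + s * \<mu> j)"
    and 0: "\<And>j. j < p \<Longrightarrow> \<mu> j = 0"
  shows "v = 0"
proof -
  have const: "mpoly_eval f (b + s *\<^sub>R v) = mpoly_eval f b" for s
    using fac 0 by simp
  then have "v \<in> closure C"
    by (rule line_roots_zero_imp_closure[OF b])
  moreover have "- v \<in> closure C"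
    using const[of "- s" for s] by (intro line_roots_zero_imp_closure[OF b]) simp
  then have "v \<in> uminus ` closure C"
    by (metis image_eqI minus_minus)
  ultimately show ?thesis
    using pointed by (auto simp: pointed_cone_def)
qed

text \<open>For p = 0 the products are empty, so \<open>f\<close> is constant on lines and
  pointedness would make every vector zero.\<close>

lemma degree_pos: "p > 0"
proof (rule ccontr)
  assume "\<not> p > 0"
  then have "v = 0" for v :: "real ^ 'n"
    using hyperbolic_mpoly_line_factorization[OF hyp, of v] line_roots_zero_imp_zero[OF base_in_cone]
    by (metis not_less_zero gr0I)
  from this[of "axis undefined 1"] show False
    by simp
qed

lemma zero_not_in_cone: "0 \<notin> C"
proof
  assume "0 \<in> C"
  then have "mpoly_eval f (0 *\<^sub>R (0 :: real ^ 'n)) \<noteq> 0"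
    using nonzero_on_cone by simp
  then show False
    unfolding mpoly_eval_scaleR[OF homogeneous] using degree_pos by simp
qed

lemma inner_log_gradient_nonneg:
  assumes b: "b \<in> C" and x: "x \<in> closure C"
  shows "x \<bullet> log_gradient f b \<ge> 0" "x \<noteq> 0 \<Longrightarrow> x \<bullet> log_gradient f b > 0"
proof -
  obtain \<mu> where \<mu>: "\<And>s. mpoly_eval f (b + s *\<^sub>R x) = mpoly_eval f b * (\<Prod>j<p. 1 + s * \<mu> j)"
    using hyperbolic_mpoly_line_factorization[OF hyperbolic_cone_direction[OF b]] by blast
  have eq: "x \<bullet> log_gradient f b = (\<Sum>j<p. \<mu> j)"
    by (rule inner_log_gradient_eq_sum[OF positive[OF b] \<mu>])
  have nonneg: "\<mu> j \<ge> 0" if "j < p" for j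
    using line_roots_nonneg[OF b x \<mu> that] .
  then show ge: "x \<bullet> log_gradient f b \<ge> 0"
    unfolding eq by (intro sum_nonneg) auto
  assume "x \<noteq> 0"
  then obtain j where "j < p" "\<mu> j \<noteq> 0"
    using line_roots_zero_imp_zero[OF b \<mu>] by blast
  then have "0 < (\<Sum>j<p. \<mu> j)"
    using nonneg by (intro sum_pos2[of _ j]) (auto simp: order_less_le)
  with eq show "x \<bullet> log_gradient f b > 0" by simp
qed

text \<open>
  Along a segment in the cone, \<open>log f\<close> is a sum of functions \<open>s \<mapsto> ln (1 + s * \<mu> j)\<close>, and
  the difference of the derivatives at the end points is \<open>\<Sum> \<mu> j ^ 2 / (1 + \<mu> j)\<close>.
\<close>

lemma log_gradient_strictly_antimono:
  assumes b: "b \<in> C" and c: "c \<in> C" and ne: "b \<noteq> c"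
  shows "(c - b) \<bullet> log_gradient f c < (c - b) \<bullet> log_gradient f b"
proof -
  define v where "v = c - b"
  obtain \<mu> where \<mu>: "\<And>s. mpoly_eval f (b + s *\<^sub>R v) = mpoly_eval f b * (\<Prod>j<p. 1 + s * \<mu> j)"
    using hyperbolic_mpoly_line_factorization[OF hyperbolic_cone_direction[OF b]] by blast
  \<comment> \<open>Otherwise s = -1 / \<mu> j lies between 0 and 1 and gives a zero of
    \<open>f\<close> on the segment from \<open>b\<close> to \<open>c\<close>, which convexity keeps
    in the cone.\<close>
  have pos: "1 + \<mu> j > 0" if j: "j < p" for j
  proof (rule ccontr)
    assume *: "\<not> 1 + \<mu> j > 0"
    define s where "s = - 1 / \<mu> j"
    have s: "0 \<le> s" "s \<le> 1" "1 + s * \<mu> j = 0"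
      using * by (auto simp: s_def field_simps)
    have "b + s *\<^sub>R v = (1 - s) *\<^sub>R b + s *\<^sub>R c"
      by (simp add: v_def algebra_simps)
    then have "b + s *\<^sub>R v \<in> C"
      using convex_cone b c s by (auto intro: convexD)
    moreover have "(\<Prod>i<p. 1 + s * \<mu> i) = 0"
      using j s(3) by (intro prod_zero) auto
    then have "mpoly_eval f (b + s *\<^sub>R v) = 0"
      by (simp only: \<mu> mult_zero_right)
    ultimately show False
      using nonzero_on_cone by blast
  qed
  have c_eq: "c = b + v"
    by (simp add: v_def)
  have fc: "mpoly_eval f c = mpoly_eval f b * (\<Prod>j<p. 1 + \<mu> j)"
    using \<mu>[of 1] by (simp add: c_eq)
  \<comment> \<open>Recentering the same line at \<open>c\<close> replaces \<mu> j by \<mu> j / (1 +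
    \<mu> j).\<close>
  have \<mu>': "mpoly_eval f (c + s *\<^sub>R v) = mpoly_eval f c * (\<Prod>j<p. 1 + s * (\<mu> j / (1 + \<mu> j)))" for s
  proof -
    have "c + s *\<^sub>R v = b + (1 + s) *\<^sub>R v"
      by (simp add: c_eq algebra_simps)
    then have "mpoly_eval f (c + s *\<^sub>R v) = mpoly_eval f b * (\<Prod>j<p. 1 + (1 + s) * \<mu> j)"
      by (simp only: \<mu>)
    also have "(\<Prod>j<p. 1 + (1 + s) * \<mu> j) = (\<Prod>j<p. (1 + \<mu> j) * (1 + s * (\<mu> j / (1 + \<mu> j))))"
    proof (rule prod.cong[OF refl])
      fix j assume "j \<in> {..<p}"
      then have "1 + \<mu> j \<noteq> 0"
        using pos[of j] by auto
      then show "1 + (1 + s) * \<mu> j = (1 + \<mu> j) * (1 + s * (\<mu> j / (1 + \<mu> j)))"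
        by (simp add: field_simps)
    qed
    finally show ?thesis
      by (simp add: fc prod.distrib)
  qed
  have "v \<noteq> 0"
    using ne by (simp add: v_def)
  then obtain j where j: "j < p" "\<mu> j \<noteq> 0"
    using line_roots_zero_imp_zero[OF b \<mu>] by blast
  have diff: "\<mu> i - \<mu> i / (1 + \<mu> i) = (\<mu> i)\<^sup>2 / (1 + \<mu> i)" if "i < p" for i
    using pos[OF that] by (simp add: field_simps power2_eq_square)
  have "0 < (\<Sum>i<p. \<mu> i - \<mu> i / (1 + \<mu> i))"
  proof (rule sum_pos2[of _ j])
    show "0 < \<mu> j - \<mu> j / (1 + \<mu> j)"
      using j pos[of j] by (simp add: diff)
    show "0 \<le> \<mu> i - \<mu> i / (1 + \<mu> i)" if "i \<in> {..<p}" for i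
      using that pos[of i] by (simp add: diff)
  qed (use j in auto)
  then show ?thesis
    unfolding v_def[symmetric] inner_log_gradient_eq_sum[OF positive[OF b] \<mu>]
      inner_log_gradient_eq_sum[OF positive[OF c] \<mu>']
    by (simp add: sum_subtractf)
qed

lemma log_gradient_in_dual_cone: "log_gradient f ` C \<subseteq> dual_cone C"
proof -
  have "0 \<le> x \<bullet> log_gradient f b" if "b \<in> C" "x \<in> C" for b x
    using inner_log_gradient_nonneg(1)[OF that(1)] that(2) closure_subset by blast
  then show ?thesis
    by (auto simp: dual_cone_def)
qed

end

subsection \<open>Linear sections\<close>

declare transpose_matrix_vector [simp del]

lemma inner_transpose_mult: "(transpose A *v x) \<bullet> y = x \<bullet> (A *v y)" for A :: "real ^ 'n ^ 'm"
  by (simp add: transpose_matrix_vector dot_lmul_matrix)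

locale complete_hyperbolic_section = complete_hyperbolic_positive p f a
  for p and f :: "'n::finite real_mpoly" and a +
  fixes L :: "real ^ 'n ^ 'c::finite"
  assumes inj: "inj (\<lambda>\<tau>. transpose L *v \<tau>)"
    and meets: "\<exists>\<tau>. transpose L *v \<tau> \<in> C"
begin

definition CL :: "(real ^ 'c) set" where
  "CL = {\<tau>. transpose L *v \<tau> \<in> C}"

text \<open>\<open>GDERIV_section\<close> identifies this composite with the gradient of the
  restricted logarithm, by the chain rule.\<close>

definition section_gradient :: "real ^ 'c \<Rightarrow> real ^ 'c" where
  "section_gradient \<tau> = L *v log_gradient f (transpose L *v \<tau>)"

lemma in_CL [simp]: "\<tau> \<in> CL \<longleftrightarrow> transpose L *v \<tau> \<in> C"
  by (simp add: CL_def)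

lemma inner_section_gradient:
  "x \<bullet> section_gradient \<tau> = (transpose L *v x) \<bullet> log_gradient f (transpose L *v \<tau>)"
  by (simp add: section_gradient_def inner_transpose_mult)

lemma continuous_on_transpose_mult: "continuous_on S (\<lambda>\<tau>. transpose L *v \<tau>)"
  by (intro linear_continuous_on linear_linear[THEN iffD2] matrix_vector_mul_linear)

lemma open_CL: "open CL"
proof -
  have "open ((\<lambda>\<tau>. transpose L *v \<tau>) -` C)"
    by (intro open_vimage open_cone continuous_on_transpose_mult)
  then show ?thesis by (simp add: CL_def vimage_def)
qed

lemma CL_nonzero: "\<tau> \<in> CL \<Longrightarrow> \<tau> \<noteq> 0"
  using zero_not_in_cone by auto

lemma CL_scaleR: "\<tau> \<in> CL \<Longrightarrow> c > 0 \<Longrightarrow> c *\<^sub>R \<tau> \<in> CL"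
  using cone_scaleR by (simp add: matrix_vector_mult_scaleR)

lemma GDERIV_section:
  assumes \<tau>: "\<tau> \<in> CL"
  shows "GDERIV (\<lambda>\<tau>. mpoly_eval f (transpose L *v \<tau>)) \<tau>
      :> mpoly_eval f (transpose L *v \<tau>) *\<^sub>R section_gradient \<tau>"
    and "GDERIV (\<lambda>\<tau>. ln (mpoly_eval f (transpose L *v \<tau>))) \<tau> :> section_gradient \<tau>"
proof -
  have pos: "mpoly_eval f (transpose L *v \<tau>) > 0"
    using \<tau> positive by simp
  have L: "((\<lambda>\<tau>. transpose L *v \<tau>) has_derivative (\<lambda>\<tau>. transpose L *v \<tau>)) (at \<tau>)"
    by (intro linear_imp_has_derivative matrix_vector_mul_linear)
  show "GDERIV (\<lambda>\<tau>. mpoly_eval f (transpose L *v \<tau>)) \<tau>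
      :> mpoly_eval f (transpose L *v \<tau>) *\<^sub>R section_gradient \<tau>"
    using has_derivative_compose[OF L log_gradient(3)[OF pos, unfolded gderiv_def]]
    by (simp add: gderiv_def inner_section_gradient)
  show "GDERIV (\<lambda>\<tau>. ln (mpoly_eval f (transpose L *v \<tau>))) \<tau> :> section_gradient \<tau>"
    using has_derivative_compose[OF L log_gradient(2)[OF pos, unfolded gderiv_def]]
    by (simp add: gderiv_def inner_section_gradient)
qed

section \<open>Injectivity and image of the gradient map on the section\<close>

lemma inj_on_section_gradient: "inj_on section_gradient CL"
proof (rule inj_onI, rule ccontr)
  fix x y assume xy: "x \<in> CL" "y \<in> CL" "section_gradient x = section_gradient y" "x \<noteq> y"
  then have "transpose L *v x \<noteq> transpose L *v y"
    using inj by (auto dest: injD)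
  from log_gradient_strictly_antimono[OF _ _ this] xy(1,2)
  have "(y - x) \<bullet> section_gradient y < (y - x) \<bullet> section_gradient x"
    by (simp add: inner_section_gradient matrix_vector_mult_diff_distrib)
  with xy show False by simp
qed

text \<open>Pairing with the gradient is strictly positive on the compact set \<open>Z\<close>, so
  it has a positive minimum \<open>m\<close> there. Perturbing the gradient by less than
  \<open>m\<close> keeps the pairing nonnegative on the cone.\<close>

lemma section_gradient_in_interior:
  assumes b: "b \<in> CL"
  shows "section_gradient b \<in> interior (dual_cone CL)"
proof -
  define Z where "Z = sphere 0 1 \<inter> {\<tau>. transpose L *v \<tau> \<in> closure C}"
  have "closed ((\<lambda>\<tau>. transpose L *v \<tau>) -` closure C)"
    by (intro closed_vimage closed_closure continuous_on_transpose_mult)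
  then have "compact Z"
    unfolding Z_def by (intro compact_Int_closed) (auto simp: vimage_def)
  have unit: "(1 / norm \<tau>) *\<^sub>R \<tau> \<in> Z" if "\<tau> \<in> CL" for \<tau>
    using CL_scaleR[OF that, of "1 / norm \<tau>"] CL_nonzero[OF that] closure_subset
    by (auto simp: Z_def)
  with b have "Z \<noteq> {}" by blast
  moreover have "continuous_on Z (\<lambda>\<tau>. \<tau> \<bullet> section_gradient b)"
    by (intro continuous_intros)
  ultimately obtain z where z: "z \<in> Z" "\<And>\<tau>. \<tau> \<in> Z \<Longrightarrow> z \<bullet> section_gradient b \<le> \<tau> \<bullet> section_gradient b"
    using continuous_attains_inf[OF \<open>compact Z\<close>] by metis
  define m where "m = z \<bullet> section_gradient b"
  have "transpose L *v z \<noteq> 0"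
    using z(1) injD[OF inj, of z 0] by (auto simp: Z_def)
  with z(1) b have "m > 0"
    unfolding m_def inner_section_gradient by (intro inner_log_gradient_nonneg(2)) (auto simp: Z_def)
  have "ball (section_gradient b) m \<subseteq> dual_cone CL"
    unfolding dual_cone_def
  proof (intro subsetI CollectI ballI)
    fix \<sigma> \<tau> assume \<sigma>: "\<sigma> \<in> ball (section_gradient b) m" and \<tau>: "\<tau> \<in> CL"
    have "m * norm \<tau> \<le> \<tau> \<bullet> section_gradient b"
      using z(2)[OF unit[OF \<tau>]] CL_nonzero[OF \<tau>] by (simp add: m_def[symmetric] pos_le_divide_eq)
    moreover have "\<tau> \<bullet> (section_gradient b - \<sigma>) \<le> norm \<tau> * m"
      using norm_cauchy_schwarz[of \<tau> "section_gradient b - \<sigma>"] \<sigma>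
      by (smt (verit) dist_norm mem_ball mult_left_mono norm_ge_zero)
    ultimately show "0 \<le> \<tau> \<bullet> \<sigma>"
      by (simp add: inner_diff_right mult.commute)
  qed
  with \<open>m > 0\<close> show ?thesis
    by (meson centre_in_ball interior_maximal open_ball subset_iff)
qed

text \<open>
  By homogeneity, a maximizer \<open>t\<close> of \<open>f\<close> on the compact slice \<open>\<tau> \<bullet> \<sigma> = p\<close> satisfies
  \<open>f \<tau> \<le> f t * (\<tau> \<bullet> \<sigma> / p) ^ p\<close> on the whole cone, with equality at \<open>t\<close>, and the
  gradients of both sides at \<open>t\<close> agree.
\<close>

lemma interior_subset_section_gradient_image:
  "interior (dual_cone CL) \<subseteq> section_gradient ` CL"
proof
  fix \<sigma> assume "\<sigma> \<in> interior (dual_cone CL)"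
  then obtain \<epsilon> where \<epsilon>: "\<epsilon> > 0" "cball \<sigma> \<epsilon> \<subseteq> dual_cone CL"
    by (meson mem_interior_cball)
  define g where "g \<tau> = mpoly_eval f (transpose L *v \<tau>)" for \<tau>
  have g_scale: "g (c *\<^sub>R \<tau>) = c ^ p * g \<tau>" for c \<tau>
    by (simp add: g_def matrix_vector_mult_scaleR mpoly_eval_scaleR[OF homogeneous])
  have cont: "continuous_on S g" for S
    unfolding g_def by (intro continuous_on_mpoly_eval continuous_on_transpose_mult)
  have coercive: "\<epsilon> * norm \<tau> \<le> \<tau> \<bullet> \<sigma>" if \<tau>: "\<tau> \<in> closure CL" for \<tau>
  proof (cases "\<tau> = 0")
    case False
    \<comment> \<open>Moving \<sigma> by \<epsilon> against the direction of \<tau> stays in the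
      dual cone; pairing the result with \<tau> gives the coercive bound.\<close>
    define \<sigma>' where "\<sigma>' = \<sigma> - (\<epsilon> / norm \<tau>) *\<^sub>R \<tau>"
    have "\<sigma>' \<in> cball \<sigma> \<epsilon>"
      using False \<epsilon>(1) by (simp add: \<sigma>'_def dist_norm)
    with \<epsilon>(2) have "CL \<subseteq> {x. 0 \<le> x \<bullet> \<sigma>'}"
      by (auto simp: dual_cone_def)
    moreover have "closed {x. 0 \<le> x \<bullet> \<sigma>'}"
      by (intro closed_Collect_le continuous_intros)
    ultimately have "closure CL \<subseteq> {x. 0 \<le> x \<bullet> \<sigma>'}"
      by (rule closure_minimal)
    with \<tau> have "0 \<le> \<tau> \<bullet> \<sigma>'"
      by blast
    with False show ?thesis
      by (simp add: \<sigma>'_def inner_diff_right dot_square_norm power2_eq_square)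
  qed simp
  have \<sigma>_pos: "\<tau> \<bullet> \<sigma> > 0" if "\<tau> \<in> CL" for \<tau>
  proof -
    have "0 < \<epsilon> * norm \<tau>"
      using \<epsilon>(1) CL_nonzero[OF that] by simp
    also have "\<dots> \<le> \<tau> \<bullet> \<sigma>"
      using that closure_subset by (intro coercive) blast
    finally show ?thesis .
  qed
  \<comment> \<open>The level \<open>p\<close> is dictated by Euler's identity: a point \<tau> whose
    gradient is \<sigma> satisfies \<tau> \<bullet> \<sigma> = p.\<close>
  define M where "M = closure CL \<inter> {\<tau>. \<tau> \<bullet> \<sigma> = p}"
  have "closed M"
    unfolding M_def by (intro closed_Int closed_closure closed_Collect_eq continuous_intros)
  moreover have "norm \<tau> \<le> p / \<epsilon>" if "\<tau> \<in> M" for \<tau>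
    using coercive[of \<tau>] that \<epsilon>(1) by (simp add: M_def pos_le_divide_eq mult.commute)
  then have "bounded M"
    by (rule boundedI)
  ultimately have "compact M"
    by (simp add: compact_eq_bounded_closed)
  have proj: "(p / (\<tau> \<bullet> \<sigma>)) *\<^sub>R \<tau> \<in> M \<inter> CL" if "\<tau> \<in> CL" for \<tau>
  proof -
    have "(p / (\<tau> \<bullet> \<sigma>)) *\<^sub>R \<tau> \<in> CL"
      using \<sigma>_pos[OF that] degree_pos by (intro CL_scaleR[OF that]) simp
    moreover from this have "(p / (\<tau> \<bullet> \<sigma>)) *\<^sub>R \<tau> \<in> closure CL"
      using closure_subset by blast
    ultimately show ?thesis
      using \<sigma>_pos[OF that] by (simp add: M_def del: in_CL)
  qed
  obtain \<tau>\<^sub>0 where \<tau>\<^sub>0: "\<tau>\<^sub>0 \<in> CL"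
    using meets by auto
  then have "M \<noteq> {}"
    using proj by blast
  then obtain t where t: "t \<in> M" "\<And>\<tau>. \<tau> \<in> M \<Longrightarrow> g \<tau> \<le> g t"
    using continuous_attains_sup[OF \<open>compact M\<close> _ cont] by metis
  \<comment> \<open>The maximum is positive, so \<open>f\<close> does not vanish at the maximizer,
    and \<open>closure_cone_nonzero\<close> puts it in the open section rather than only in its
    closure.\<close>
  have "g ((p / (\<tau>\<^sub>0 \<bullet> \<sigma>)) *\<^sub>R \<tau>\<^sub>0) > 0"
    unfolding g_def using proj[OF \<tau>\<^sub>0] by (intro positive) (simp add: CL_def)
  with t(2) proj[OF \<tau>\<^sub>0] have gt: "g t > 0"
    by force
  have "t \<in> closure CL"
    using t(1) by (simp add: M_def)
  then have "transpose L *v t \<in> closure ((\<lambda>\<tau>. transpose L *v \<tau>) ` CL)"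
    using closure_linear_image_subset[of "\<lambda>\<tau>. transpose L *v \<tau>" CL] matrix_vector_mul_linear by blast
  also have "\<dots> \<subseteq> closure C"
    by (intro closure_mono) auto
  finally have tC: "t \<in> CL"
    using gt closure_cone_nonzero by (simp add: g_def)
  have t\<sigma>: "t \<bullet> \<sigma> = p"
    using t(1) by (simp add: M_def)
  define \<phi> where "\<phi> \<tau> = g \<tau> - g t * ((\<tau> \<bullet> \<sigma>) / p) ^ p" for \<tau>
  have "\<phi> \<tau> \<le> \<phi> t" if \<tau>: "\<tau> \<in> CL" for \<tau>
  proof -
    have "(p / (\<tau> \<bullet> \<sigma>)) ^ p * g \<tau> \<le> g t"
      using t(2) proj[OF \<tau>] by (simp flip: g_scale)
    then have "g \<tau> \<le> g t * ((\<tau> \<bullet> \<sigma>) / p) ^ p"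
      using \<sigma>_pos[OF \<tau>] degree_pos by (simp add: power_divide field_simps)
    then show ?thesis
      using degree_pos by (simp add: \<phi>_def t\<sigma>)
  qed
  moreover have "(\<phi> has_derivative (\<lambda>h. h \<bullet> (g t *\<^sub>R section_gradient t) - g t * (h \<bullet> \<sigma>))) (at t)"
  proof -
    have "(g has_derivative (\<lambda>h. h \<bullet> (g t *\<^sub>R section_gradient t))) (at t)"
      using GDERIV_section(1)[OF tC] by (simp add: gderiv_def g_def[abs_def])
    \<comment> \<open>At \<open>t\<close> the base of the power is 1, and the exponent
      \<open>p\<close> cancels the divisor \<open>p\<close>.\<close>
    moreover have "((\<lambda>\<tau>. g t * ((\<tau> \<bullet> \<sigma>) / p) ^ p) has_derivative (\<lambda>h. g t * (h \<bullet> \<sigma>))) (at t)"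
      using degree_pos t\<sigma> by (auto intro!: derivative_eq_intros)
    ultimately show ?thesis
      unfolding \<phi>_def by (rule has_derivative_diff)
  qed
  ultimately have eq: "(\<lambda>h. h \<bullet> (g t *\<^sub>R section_gradient t) - g t * (h \<bullet> \<sigma>)) = (\<lambda>h. 0)"
    using differential_zero_maxmin[OF tC open_CL] by blast
  have "h \<bullet> section_gradient t = h \<bullet> \<sigma>" for h
    using fun_cong[OF eq, of h] gt by simp
  then have "section_gradient t = \<sigma>"
    by (metis inner_commute vector_eq_ldot)
  with tC show "\<sigma> \<in> section_gradient ` CL"
    by blast
qed

lemma section_gradient_image: "section_gradient ` CL = interior (dual_cone CL)"
  using section_gradient_in_interior interior_subset_section_gradient_image by blast

text \<open>
  A point of \<open>C\<close> on the subspace bounds \<open>\<sigma>\<close> in terms of \<open>L *v \<sigma>\<close> for \<open>\<sigma> \<in> dual_cone C\<close>.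
\<close>

lemma closed_dual_cone_image: "closed ((\<lambda>\<sigma>. L *v \<sigma>) ` dual_cone C)"
proof -
  obtain \<tau> where \<tau>: "transpose L *v \<tau> \<in> C"
    using meets by blast
  then obtain e where e: "e > 0" "cball (transpose L *v \<tau>) e \<subseteq> C"
    using open_cone open_contains_cball by blast
  have bound: "e * norm \<sigma> \<le> \<tau> \<bullet> (L *v \<sigma>)" if \<sigma>: "\<sigma> \<in> dual_cone C" for \<sigma>
  proof (cases "\<sigma> = 0")
    case False
    have "transpose L *v \<tau> - (e / norm \<sigma>) *\<^sub>R \<sigma> \<in> C"
      using False e by (intro subsetD[OF e(2)]) (simp add: dist_norm)
    with \<sigma> have "0 \<le> (transpose L *v \<tau> - (e / norm \<sigma>) *\<^sub>R \<sigma>) \<bullet> \<sigma>"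
      by (simp add: dual_cone_def)
    with False show ?thesis
      by (simp add: inner_diff_left dot_square_norm power2_eq_square inner_transpose_mult)
  qed simp
  have closed_dual: "closed (dual_cone C)"
  proof -
    have "dual_cone C = (\<Inter>x\<in>C. {\<sigma>. 0 \<le> x \<bullet> \<sigma>})"
      by (auto simp: dual_cone_def)
    also have "closed \<dots>"
      by (intro closed_INT ballI closed_Collect_le continuous_intros)
    finally show ?thesis .
  qed
  show ?thesis
    unfolding closed_sequential_limits
  proof (intro allI impI, elim conjE)
    fix y l assume y: "\<forall>n. y n \<in> (\<lambda>\<sigma>. L *v \<sigma>) ` dual_cone C" and l: "y \<longlonglongrightarrow> l"
    from y have "\<forall>n. \<exists>\<sigma>. \<sigma> \<in> dual_cone C \<and> y n = L *v \<sigma>"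
      by blast
    then obtain s where s: "\<And>n. s n \<in> dual_cone C" "\<And>n. y n = L *v s n"
      by metis
    obtain B where B: "\<And>n. norm (y n) \<le> B"
      using convergent_imp_bounded[OF l] unfolding bounded_iff by blast
    \<comment> \<open>The bound makes the chosen preimages bounded, so a subsequence converges in
      the dual cone, and its limit is mapped to \<open>l\<close>.\<close>
    have "norm (s n) \<le> norm \<tau> * B / e" for n
    proof -
      have "e * norm (s n) \<le> norm \<tau> * norm (y n)"
        using bound[OF s(1), of n] norm_cauchy_schwarz[of \<tau> "y n"] by (simp add: s(2))
      also have "\<dots> \<le> norm \<tau> * B"
        using B by (intro mult_left_mono) auto
      finally show ?thesis
        using e(1) by (simp add: pos_le_divide_eq mult.commute)
    qed
    then have "\<forall>n. s n \<in> dual_cone C \<inter> cball 0 (norm \<tau> * B / e)"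
      using s(1) by simp
    moreover have "compact (dual_cone C \<inter> cball 0 (norm \<tau> * B / e))"
      by (intro closed_Int_compact closed_dual compact_cball)
    ultimately obtain \<sigma> r where \<sigma>: "\<sigma> \<in> dual_cone C" "strict_mono r" "(s \<circ> r) \<longlonglongrightarrow> \<sigma>"
      unfolding compact_def by blast
    have "(\<lambda>n. L *v (s \<circ> r) n) \<longlonglongrightarrow> L *v \<sigma>"
      using \<sigma>(3) by (intro bounded_linear.tendsto[OF matrix_vector_mul_bounded_linear])
    moreover have "(\<lambda>n. L *v (s \<circ> r) n) \<longlonglongrightarrow> l"
      using LIMSEQ_subseq_LIMSEQ[OF l \<sigma>(2)] by (simp add: o_def s(2))
    ultimately have "l = L *v \<sigma>"
      by (metis LIMSEQ_unique)
    with \<sigma>(1) show "l \<in> (\<lambda>\<sigma>. L *v \<sigma>) ` dual_cone C"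
      by blast
  qed
qed

lemma convex_dual_cone: "convex (dual_cone S)" for S :: "'b::real_inner set"
  by (auto simp: dual_cone_def convex_def inner_add_right)

lemma dual_cone_image: "(\<lambda>\<sigma>. L *v \<sigma>) ` dual_cone C = dual_cone CL"
proof
  show "(\<lambda>\<sigma>. L *v \<sigma>) ` dual_cone C \<subseteq> dual_cone CL"
    by (auto simp: dual_cone_def simp flip: inner_transpose_mult)
  have "interior (dual_cone CL) \<subseteq> (\<lambda>\<sigma>. L *v \<sigma>) ` dual_cone C"
    unfolding section_gradient_image[symmetric]
    using log_gradient_in_dual_cone by (fastforce simp: section_gradient_def)
  then have "closure (interior (dual_cone CL)) \<subseteq> (\<lambda>\<sigma>. L *v \<sigma>) ` dual_cone C"
    using closed_dual_cone_image by (rule closure_minimal)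
  \<comment> \<open>A convex set with nonempty interior is contained in the closure of that
    interior; the gradient at a point of the section supplies an interior point.\<close>
  moreover have "interior (dual_cone CL) \<noteq> {}"
    using meets section_gradient_in_interior by fastforce
  then have "closure (interior (dual_cone CL)) = closure (dual_cone CL)"
    by (intro convex_closure_interior convex_dual_cone)
  ultimately show "dual_cone CL \<subseteq> (\<lambda>\<sigma>. L *v \<sigma>) ` dual_cone C"
    using closure_subset by blast
qed

end

section \<open>Coordinates on the subspace and the final assembly\<close>

lemma transpose_full_row_rank:
  fixes L :: "real ^ 'n::finite ^ 'c::finite"
  assumes "dim (span (rows L)) = CARD('c)"
  shows "inj (\<lambda>\<tau>. transpose L *v \<tau>)" "range (\<lambda>\<tau>. transpose L *v \<tau>) = span (rows L)"
proof -
  have "rank (transpose L) = CARD('c)"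
    using assms by (simp only: rank_transpose row_rank_def[of L] dim_span)
  then show inj: "inj (\<lambda>\<tau>. transpose L *v \<tau>)"
    by (rule full_rank_injective[THEN iffD1])
  have "range (\<lambda>\<tau>. transpose L *v \<tau>) \<subseteq> span (rows L)"
    using matrix_vector_mult_in_columnspace[of "transpose L"] by (auto simp: columns_transpose)
  moreover have "subspace (range (\<lambda>\<tau>. transpose L *v \<tau>))"
    by (intro linear_subspace_image matrix_vector_mul_linear subspace_UNIV)
  moreover have "dim (range (\<lambda>\<tau>. transpose L *v \<tau>)) = CARD('c)"
    using dim_image_eq[OF matrix_vector_mul_linear, of "transpose L" UNIV] inj
    by (simp add: inj_on_def inj_def)
  ultimately show "range (\<lambda>\<tau>. transpose L *v \<tau>) = span (rows L)"
    using assms by (intro subspace_dim_equal) auto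
qed

theorem theorem4p5:
  fixes p :: nat
    and f :: "'d::finite real_mpoly"
    and \<tau>\<^sub>0 :: "real ^ 'd"
    and C K \<L> :: "(real ^ 'd) set"
    and F :: "real ^ 'd \<Rightarrow> real ^ 'd"
    and L :: "real ^ 'd ^ 'c::finite"
    and C\<^sub>L K\<^sub>L :: "(real ^ 'c) set"
    and F\<^sub>L :: "real ^ 'c \<Rightarrow> real ^ 'c"
  assumes complete: "complete_hyperbolic p f \<tau>\<^sub>0"
    and C: "C = hyperbolicity_cone f \<tau>\<^sub>0"
    and sign: "\<forall>\<theta>\<in>C. mpoly_eval f \<theta> > 0"
    and K: "K = dual_cone C"
    and F: "F = gradient (\<lambda>\<theta>. ln (mpoly_eval f \<theta>))"
    and \<L>: "subspace \<L>" "dim \<L> = CARD('c)" "\<L> \<inter> C \<noteq> {}"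
    and L: "independent (rows L)" "span (rows L) = \<L>"
    and C\<^sub>L: "C\<^sub>L = {\<tau>. transpose L *v \<tau> \<in> C}"
    and K\<^sub>L: "K\<^sub>L = (\<lambda>\<sigma>. L *v \<sigma>) ` K"
    and F\<^sub>L: "F\<^sub>L = gradient (\<lambda>\<tau>. ln (mpoly_eval f (transpose L *v \<tau>)))"
  shows
    "(\<forall>\<theta>\<in>C. F \<theta> = (1 / mpoly_eval f \<theta>) *\<^sub>R gradient (mpoly_eval f) \<theta>)
     \<and> K\<^sub>L = dual_cone C\<^sub>L
     \<and> bij_betw (\<lambda>\<tau>. transpose L *v \<tau>) C\<^sub>L (C \<inter> \<L>)
     \<and> F ` C \<subseteq> K
     \<and> (\<forall>\<tau>\<in>C\<^sub>L. F\<^sub>L \<tau> = L *v F (transpose L *v \<tau>))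
     \<and> bij_betw (\<lambda>\<tau>. F (transpose L *v \<tau>)) C\<^sub>L (F ` (C \<inter> \<L>))
     \<and> bij_betw (\<lambda>\<sigma>. L *v \<sigma>) (F ` (C \<inter> \<L>)) (interior K\<^sub>L)"
proof -
  have inj: "inj (\<lambda>\<tau>. transpose L *v \<tau>)" and range: "range (\<lambda>\<tau>. transpose L *v \<tau>) = \<L>"
    using transpose_full_row_rank[of L] \<L>(2) L(2) by simp_all
  interpret complete_hyperbolic_section p f \<tau>\<^sub>0 L
  proof
    show "\<exists>\<tau>. transpose L *v \<tau> \<in> hyperbolicity_cone f \<tau>\<^sub>0"
      using \<L>(3) C by (auto simp flip: range)
  qed (use complete sign C inj in \<open>auto simp: complete_hyperbolic_def\<close>)
  have CL: "C\<^sub>L = CL"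
    by (simp add: C\<^sub>L C CL_def)
  have gradient_eq: "section_gradient = (\<lambda>\<tau>. L *v F (transpose L *v \<tau>))"
    by (simp add: section_gradient_def F fun_eq_iff)
  have image: "(\<lambda>\<tau>. transpose L *v \<tau>) ` C\<^sub>L = C \<inter> \<L>"
    by (auto simp: C\<^sub>L simp flip: range)
  have inj_F: "inj_on (\<lambda>\<tau>. F (transpose L *v \<tau>)) C\<^sub>L"
    using inj_on_section_gradient unfolding gradient_eq CL by (auto simp: inj_on_def)
  have image_F: "(\<lambda>\<tau>. F (transpose L *v \<tau>)) ` C\<^sub>L = F ` (C \<inter> \<L>)"
    by (simp flip: image add: image_image)
  have "\<forall>\<theta>\<in>C. F \<theta> = (1 / mpoly_eval f \<theta>) *\<^sub>R gradient (mpoly_eval f) \<theta>"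
    unfolding F using log_gradient(1) sign by blast
  moreover have K\<^sub>L_eq: "K\<^sub>L = dual_cone C\<^sub>L"
    using dual_cone_image by (simp add: K\<^sub>L K C CL)
  moreover have "bij_betw (\<lambda>\<tau>. transpose L *v \<tau>) C\<^sub>L (C \<inter> \<L>)"
    using inj image by (auto simp: bij_betw_def intro: inj_on_subset)
  moreover have "F ` C \<subseteq> K"
    using log_gradient_in_dual_cone by (simp add: F K C)
  moreover have "\<forall>\<tau>\<in>C\<^sub>L. F\<^sub>L \<tau> = L *v F (transpose L *v \<tau>)"
    using gradient_eqI[OF GDERIV_section(2)] by (simp add: F\<^sub>L CL gradient_eq)
  moreover have "bij_betw (\<lambda>\<tau>. F (transpose L *v \<tau>)) C\<^sub>L (F ` (C \<inter> \<L>))"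
    using inj_F image_F by (simp add: bij_betw_def)
  \<comment> \<open>Injectivity of \<open>L\<close> is needed only on the image of \<open>F\<close>,
    where it follows from injectivity of the composite \<open>section_gradient\<close>; surjectivity
    is \<open>section_gradient_image\<close>.\<close>
  moreover have "bij_betw (\<lambda>\<sigma>. L *v \<sigma>) (F ` (C \<inter> \<L>)) (interior K\<^sub>L)"
    unfolding K\<^sub>L_eq CL section_gradient_image[symmetric] image_F[symmetric] gradient_eq
    using inj_on_section_gradient by (auto simp: bij_betw_def gradient_eq inj_on_def image_image)
  ultimately show ?thesis
    by blast
qed

end
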